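(* Let $\varepsilon \in (0,1)$ be arbitrary. There exist $C > 0$ and $d_0 \in \mathbb{N}$ such that for every integer $d \ge d_0$ and every real $f \ge C$, there exists a $d$-degenerate graph $G$ that admits a left $\frac{d^2}{f}$-locally-sparse degeneracy ordering such that $$\chi_f(G) \ge (1-\varepsilon)\frac{d}{\log f}.$$
   Context: All graphs are finite, simple and undirected; $\log$ is the natural logarithm. The fractional chromatic number $\chi_f(G)$ is the minimum of $\sum_{I}\lambda_I$ over nonnegative real weights $\lambda_I$ indexed by the independent sets $I$ of $G$ such that $\sum_{I \ni v}\lambda_I \ge 1$ for every $v \in V(G)$. A graph is $d$-degenerate if it admits a vertex ordering $(v_1,\dots,v_n)$ in which each $v_i$ has at most $d$ back-neighbors, i.e. neighbors $v_j$ with $j<i$; such an ordering is called a degeneracy ordering. For $k \in \mathbb{R}$, an ordering $(v_1,\dots,v_n)$ of $V(G)$ is left $k$-locally-sparse if for each $i$ the induced subgraph $G[N(v_i)\cap\{v_1,\dots,v_{i-1}\}]$ has at most $\lfloor k\rfloor$ edges. A left $k$-locally-sparse degeneracy ordering is a single ordering having both properties (at most $d$ back-neighbors per vertex and left $k$-locally-sparse). *)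

theory Defs
  imports "HOL-Analysis.Analysis"
begin

definition simple_graph :: "'a set \<Rightarrow> 'a set set \<Rightarrow> bool" where
  "simple_graph V E \<longleftrightarrow> finite V \<and> (\<forall>e\<in>E. e \<subseteq> V \<and> card e = 2)"

definition nbhd :: "'a set set \<Rightarrow> 'a \<Rightarrow> 'a set" where
  "nbhd E v = {u. {u, v} \<in> E}"

definition induced_edges :: "'a set set \<Rightarrow> 'a set \<Rightarrow> 'a set set" where
  "induced_edges E S = {e \<in> E. e \<subseteq> S}"

definition vertex_ordering :: "'a set \<Rightarrow> 'a list \<Rightarrow> bool" where
  "vertex_ordering V vs \<longleftrightarrow> distinct vs \<and> set vs = V"

definition back_nbhd :: "'a set set \<Rightarrow> 'a list \<Rightarrow> nat \<Rightarrow> 'a set" where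
  "back_nbhd E vs i = nbhd E (vs ! i) \<inter> set (take i vs)"

definition degeneracy_ordering :: "'a set \<Rightarrow> 'a set set \<Rightarrow> nat \<Rightarrow> 'a list \<Rightarrow> bool" where
  "degeneracy_ordering V E d vs \<longleftrightarrow>
     vertex_ordering V vs \<and> (\<forall>i < length vs. card (back_nbhd E vs i) \<le> d)"

definition degenerate :: "'a set \<Rightarrow> 'a set set \<Rightarrow> nat \<Rightarrow> bool" where
  "degenerate V E d \<longleftrightarrow> (\<exists>vs. degeneracy_ordering V E d vs)"

definition left_locally_sparse :: "'a set \<Rightarrow> 'a set set \<Rightarrow> real \<Rightarrow> 'a list \<Rightarrow> bool" where
  "left_locally_sparse V E k vs \<longleftrightarrow>
     vertex_ordering V vs \<and>
     (\<forall>i < length vs. int (card (induced_edges E (back_nbhd E vs i))) \<le> \<lfloor>k\<rfloor>)"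

definition indep_sets :: "'a set \<Rightarrow> 'a set set \<Rightarrow> 'a set set" where
  "indep_sets V E = {I. I \<subseteq> V \<and> induced_edges E I = {}}"

definition fractional_colouring :: "'a set \<Rightarrow> 'a set set \<Rightarrow> ('a set \<Rightarrow> real) \<Rightarrow> bool" where
  "fractional_colouring V E w \<longleftrightarrow>
     (\<forall>I \<in> indep_sets V E. w I \<ge> 0) \<and>
     (\<forall>v \<in> V. (\<Sum>I \<in> {I \<in> indep_sets V E. v \<in> I}. w I) \<ge> 1)"

(* For a finite simple graph this infimum is a minimum:
   see fractional_chromatic_number_attained and fractional_chromatic_number_le. *)
definition fractional_chromatic_number :: "'a set \<Rightarrow> 'a set set \<Rightarrow> real" where
  "fractional_chromatic_number V E =
     Inf {(\<Sum>I \<in> indep_sets V E. w I) | w. fractional_colouring V E w}"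

lemma finite_indep_sets: "simple_graph V E \<Longrightarrow> finite (indep_sets V E)"
  unfolding simple_graph_def indep_sets_def
  by (rule finite_subset[of _ "Pow V"]) auto

lemma fractional_chromatic_number_le:
  assumes "fractional_colouring V E w"
  shows "fractional_chromatic_number V E \<le> (\<Sum>I \<in> indep_sets V E. w I)"
  unfolding fractional_chromatic_number_def
proof (rule cInf_lower)
  show "bdd_below {(\<Sum>I \<in> indep_sets V E. w I) | w. fractional_colouring V E w}"
    by (rule bdd_belowI[of _ 0]) (auto simp: fractional_colouring_def intro!: sum_nonneg)
qed (use assms in blast)

lemma fractional_colouring_one:
  assumes "simple_graph V E"
  shows "fractional_colouring V E (\<lambda>_. 1)"
proof -
  have "1 \<le> (\<Sum>I \<in> {I \<in> indep_sets V E. v \<in> I}. (1::real))" if "v \<in> V" for v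
  proof -
    have "{v} \<in> indep_sets V E"
    proof -
      have "\<not> e \<subseteq> {v}" if "e \<in> E" for e
      proof
        assume "e \<subseteq> {v}"
        then have "card e \<le> 1" using card_mono[of "{v}" e] by simp
        with assms that show False by (auto simp: simple_graph_def)
      qed
      with \<open>v \<in> V\<close> show ?thesis by (auto simp: indep_sets_def induced_edges_def)
    qed
    then have "(\<Sum>I \<in> {{v}}. (1::real)) \<le> (\<Sum>I \<in> {I \<in> indep_sets V E. v \<in> I}. 1)"
      by (intro sum_mono2) (use finite_indep_sets[OF assms] in auto)
    then show ?thesis by simp
  qed
  then show ?thesis by (simp add: fractional_colouring_def)
qed

lemma fractional_chromatic_number_attained:
  assumes G: "simple_graph V E"
  shows "\<exists>w. fractional_colouring V E w \<and>
    fractional_chromatic_number V E = (\<Sum>I \<in> indep_sets V E. w I)"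
proof -
  note fin = finite_indep_sets[OF G]
  define F where "F = (\<lambda>w. \<Sum>I \<in> indep_sets V E. w I :: real)"
  define B where "B = (UNIV :: 'a set set) \<rightarrow>\<^sub>E {0..1::real}"
  define K where "K = B \<inter> {w. \<forall>v\<in>V. (\<Sum>I \<in> {I \<in> indep_sets V E. v \<in> I}. w I) \<ge> 1}"
  have "compact B"
    unfolding B_def
    by (metis compact_Icc compactin_PiE compactin_euclidean_iff euclidean_product_topology)
  moreover have "closed {w. \<forall>v\<in>V. (\<Sum>I \<in> {I \<in> indep_sets V E. v \<in> I}. w I) \<ge> (1::real)}"
    unfolding Collect_ball_eq
    by (intro closed_INT ballI closed_Collect_le continuous_on_const continuous_on_sum
        continuous_on_product_coordinates)
  ultimately have "compact K"
    unfolding K_def by (rule compact_Int_closed)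
  moreover have "(\<lambda>_. 1) \<in> K"
    using fractional_colouring_one[OF G] by (auto simp: K_def B_def fractional_colouring_def)
  moreover have "continuous_on K F"
    unfolding F_def
    by (intro continuous_on_sum continuous_on_subset[OF continuous_on_product_coordinates]) auto
  ultimately obtain m where m: "m \<in> K" "\<And>w. w \<in> K \<Longrightarrow> F m \<le> F w"
    using continuous_attains_inf[of K F] by blast
  have mc: "fractional_colouring V E m"
    using m(1) by (auto simp: K_def B_def fractional_colouring_def PiE_def Pi_def)
  have least: "F m \<le> F w" if w: "fractional_colouring V E w" for w
  proof -
    define u where "u = (\<lambda>I. if I \<in> indep_sets V E then min 1 (w I) else 0)"
    have u0: "0 \<le> u I" "u I \<le> 1" for I
      using w by (auto simp: u_def fractional_colouring_def)
    have "(\<Sum>I \<in> {I \<in> indep_sets V E. v \<in> I}. u I) \<ge> 1" if v: "v \<in> V" for v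
    proof (cases "\<exists>J \<in> {I \<in> indep_sets V E. v \<in> I}. w J \<ge> 1")
      case True
      then obtain J where J: "J \<in> {I \<in> indep_sets V E. v \<in> I}" "w J \<ge> 1" by blast
      have "u J \<le> (\<Sum>I \<in> {I \<in> indep_sets V E. v \<in> I}. u I)"
        by (rule member_le_sum[OF J(1)]) (use u0 fin in auto)
      with J show ?thesis by (auto simp: u_def)
    next
      case False
      then have "(\<Sum>I \<in> {I \<in> indep_sets V E. v \<in> I}. u I)
          = (\<Sum>I \<in> {I \<in> indep_sets V E. v \<in> I}. w I)"
        by (intro sum.cong) (auto simp: u_def)
      with w v show ?thesis by (auto simp: fractional_colouring_def)
    qed
    then have "u \<in> K" using u0 by (auto simp: K_def B_def)
    then have "F m \<le> F u" by (rule m(2))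
    also have "F u \<le> F w"
      unfolding F_def by (rule sum_mono) (auto simp: u_def)
    finally show ?thesis .
  qed
  have "fractional_chromatic_number V E = F m"
  proof (rule antisym)
    show "fractional_chromatic_number V E \<le> F m"
      unfolding F_def by (rule fractional_chromatic_number_le[OF mc])
    show "F m \<le> fractional_chromatic_number V E"
      unfolding fractional_chromatic_number_def
      by (rule cInf_greatest) (use mc least in \<open>auto simp: F_def\<close>)
  qed
  with mc show ?thesis unfolding F_def by blast
qed

end

theory Submission
  imports Defs
begin

text \<open>
  Zykov's construction, with weights: from a triangle-free graph \<open>G\<close> with a probability measure
  \<open>\<mu>\<close> on its vertices, take \<open>D\<close> disjoint copies of \<open>G\<close> and join one new vertex to each
  transversal, i.e. to each choice of one vertex per copy. Put mass \<open>1 - \<eta>\<close> on the copies and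
  the \<open>\<eta>\<close>-multiple of the product measure on the new vertices. If an independent set has average
  mass \<open>a\<close> in the copies, at most a fraction \<open>exp (- D a)\<close> of the transversals avoid it, so its new
  mass is at most \<open>(1 - \<eta>) a + \<eta> exp (- D a)\<close>. For \<open>\<eta> = 1 / (D + 1)\<close> this map is monotone and
  maps \<open>B \<ge> ln D / D\<close> to at most \<open>(1 - \<eta>) B + \<eta> ln D / D\<close>. Iterating, the largest mass of an
  independent set tends to at most \<open>ln D / D\<close>, which makes the fractional chromatic number at
  least \<open>(1 - o(1)) D / ln D\<close>, while every vertex has at most \<open>D\<close> back-neighbours, no two of them
  adjacent.

  If \<open>f\<close> is at least a small multiple of \<open>d\<close>, take \<open>D = d\<close>. Otherwise take \<open>D \<approx> 2 f\<close> and replace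
  every vertex by a clique of size \<open>t = d div (D + 1)\<close>; this multiplies the fractional chromatic
  number by \<open>t\<close> and creates at most \<open>(2 D + 1) t (t - 1)\<close> edges in a back-neighbourhood.
\<close>

section \<open>Graphs given by back-neighbourhoods, and a dual bound for the fractional chromatic
  number\<close>

text \<open>Graphs on \<open>{..<n}\<close> are given by the back-neighbourhoods \<open>N v\<close> in the natural order.\<close>

definition back_graph :: "nat \<Rightarrow> (nat \<Rightarrow> nat set) \<Rightarrow> bool" where
  "back_graph n N \<longleftrightarrow> (\<forall>v<n. N v \<subseteq> {..<v})"

definition edges_of :: "nat \<Rightarrow> (nat \<Rightarrow> nat set) \<Rightarrow> nat set set" where
  "edges_of n N = {{u, v} | u v. v < n \<and> u \<in> N v}"

definition stable_set :: "(nat \<Rightarrow> nat set) \<Rightarrow> nat set \<Rightarrow> bool" where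
  "stable_set N I \<longleftrightarrow> (\<forall>v\<in>I. N v \<inter> I = {})"

lemma simple_graph_edges_of:
  assumes "back_graph n N"
  shows "simple_graph {..<n} (edges_of n N)"
  unfolding simple_graph_def
proof (intro conjI ballI)
  fix e assume "e \<in> edges_of n N"
  then obtain u v where "e = {u, v}" "v < n" "u \<in> N v"
    by (auto simp: edges_of_def)
  moreover from this assms have "u < v"
    by (auto simp: back_graph_def)
  ultimately show "e \<subseteq> {..<n}" "card e = 2" by auto
qed simp

lemma indep_sets_edges_of:
  assumes "I \<in> indep_sets {..<n} (edges_of n N)"
  shows "I \<subseteq> {..<n}" and "stable_set N I"
proof -
  show I: "I \<subseteq> {..<n}" using assms by (auto simp: indep_sets_def)
  have "False" if "v \<in> I" "u \<in> N v" "u \<in> I" for u v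
  proof -
    have "{u, v} \<in> induced_edges (edges_of n N) I"
      using that I by (auto simp: induced_edges_def edges_of_def)
    with assms show False by (simp add: indep_sets_def)
  qed
  then show "stable_set N I" by (auto simp: stable_set_def)
qed

lemma vertex_ordering_upt: "vertex_ordering {..<n} [0..<n]"
  by (auto simp: vertex_ordering_def)

lemma back_nbhd_edges_of:
  assumes "back_graph n N" "i < n"
  shows "back_nbhd (edges_of n N) [0..<n] i = N i"
  using assms
  by (force simp: back_nbhd_def nbhd_def edges_of_def back_graph_def doubleton_eq_iff)

text \<open>Weak LP duality: multiply the covering constraint of each vertex \<open>v\<close> by
  \<open>\<mu> v\<close>, sum over \<open>v\<close> and exchange the sums, so that each
  \<open>w I\<close> is multiplied by the mass of \<open>I\<close>.\<close>

lemma fractional_chromatic_number_ge: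
  assumes G: "simple_graph V E" and "0 < B"
    and weight: "\<And>v. v \<in> V \<Longrightarrow> 0 \<le> \<mu> v"
    and indep: "\<And>I. I \<in> indep_sets V E \<Longrightarrow> sum \<mu> I \<le> B"
  shows "sum \<mu> V / B \<le> fractional_chromatic_number V E"
proof -
  obtain w where w: "fractional_colouring V E w"
    and eq: "fractional_chromatic_number V E = (\<Sum>I \<in> indep_sets V E. w I)"
    using fractional_chromatic_number_attained[OF G] by blast
  let ?S = "indep_sets V E"
  have fS: "finite ?S" and fV: "finite V"
    using finite_indep_sets[OF G] G by (auto simp: simple_graph_def)
  have "sum \<mu> V \<le> (\<Sum>v\<in>V. \<mu> v * (\<Sum>I \<in> {I \<in> ?S. v \<in> I}. w I))"
  proof (rule sum_mono)
    fix v assume "v \<in> V"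
    with w weight have "1 \<le> (\<Sum>I \<in> {I \<in> ?S. v \<in> I}. w I)" "0 \<le> \<mu> v"
      by (auto simp: fractional_colouring_def)
    from mult_left_mono[OF this]
    show "\<mu> v \<le> \<mu> v * (\<Sum>I \<in> {I \<in> ?S. v \<in> I}. w I)" by simp
  qed
  also have "\<dots> = (\<Sum>v\<in>V. \<Sum>I\<in>?S. if v \<in> I then \<mu> v * w I else 0)"
    using fS by (simp add: sum_distrib_left sum.If_cases Int_def)
  also have "\<dots> = (\<Sum>I\<in>?S. \<Sum>v\<in>V. if v \<in> I then \<mu> v * w I else 0)"
    by (rule sum.swap)
  also have "\<dots> = (\<Sum>I\<in>?S. w I * sum \<mu> I)"
  proof (rule sum.cong[OF refl])
    fix I assume "I \<in> ?S"
    then have "V \<inter> I = I" by (auto simp: indep_sets_def)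
    then show "(\<Sum>v\<in>V. if v \<in> I then \<mu> v * w I else 0) = w I * sum \<mu> I"
      using fV by (simp add: sum.If_cases sum_distrib_left mult.commute)
  qed
  also have "\<dots> \<le> (\<Sum>I\<in>?S. w I * B)"
    using w indep by (intro sum_mono mult_left_mono) (auto simp: fractional_colouring_def)
  also have "\<dots> = fractional_chromatic_number V E * B"
    by (simp add: eq sum_distrib_right)
  finally show ?thesis
    using \<open>0 < B\<close> by (simp add: pos_divide_le_eq)
qed

section \<open>The weighted Zykov construction\<close>

text \<open>Stability of every \<open>N v\<close> is triangle-freeness: the largest vertex of a
  triangle would have the other two as adjacent back-neighbours.\<close>

definition weighted_triangle_free ::
    "nat \<Rightarrow> nat \<Rightarrow> (nat \<Rightarrow> nat set) \<Rightarrow> (nat \<Rightarrow> real) \<Rightarrow> real \<Rightarrow> bool" where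
  "weighted_triangle_free D n N \<mu> B \<longleftrightarrow>
     back_graph n N \<and> (\<forall>v<n. card (N v) \<le> D \<and> stable_set N (N v)) \<and>
     (\<forall>v<n. 0 \<le> \<mu> v) \<and> sum \<mu> {..<n} = 1 \<and>
     (\<forall>I. I \<subseteq> {..<n} \<longrightarrow> stable_set N I \<longrightarrow> sum \<mu> I \<le> B)"

lemma weighted_triangle_free_mono:
  "weighted_triangle_free D n N \<mu> B \<Longrightarrow> B \<le> B' \<Longrightarrow> weighted_triangle_free D n N \<mu> B'"
  unfolding weighted_triangle_free_def by (meson order_trans)

text \<open>Since \<open>1 - \<eta> = \<eta> * D\<close>, the left side has derivative
  \<open>\<eta> * D * (1 - exp (- (D * a)))\<close>, which is nonnegative, so \<open>a\<close> may
  be replaced by \<open>B\<close>. Then \<open>exp (- (D * B))\<close> is at most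
  \<open>1 / D\<close>, and \<open>1 \<le> ln D\<close> because \<open>3 \<le> D\<close>.
  Monotonicity is derived from the tangent bound \<open>1 - x \<le> exp (- x)\<close> instead of
  calculus.\<close>

lemma descent_step:
  fixes D :: nat and a B :: real
  assumes D: "3 \<le> D" and \<eta>: "\<eta> = 1 / (real D + 1)"
    and "0 \<le> a" "a \<le> B" "ln D / D \<le> B"
  shows "(1 - \<eta>) * a + \<eta> * exp (- (D * a)) \<le> (1 - \<eta>) * B + \<eta> * (ln D / D)"
proof -
  have D0: "0 < real D" using D by simp
  have "1 \<le> ln (real D)"
    using D exp_le by (subst ln_ge_iff) auto
  then have inv_le: "1 / real D \<le> ln D / D"
    by (intro divide_right_mono) auto
  have \<eta>D: "1 - \<eta> = \<eta> * D" "0 < \<eta>"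
    using D0 by (auto simp: \<eta> field_simps)
  have "exp (- (D * a)) * (1 - D * (B - a)) \<le> exp (- (D * B))"
  proof -
    have "1 - D * (B - a) \<le> exp (- (D * (B - a)))"
      using exp_ge_add_one_self[of "- (D * (B - a))"] by simp
    then have "exp (- (D * a)) * (1 - D * (B - a))
        \<le> exp (- (D * a)) * exp (- (D * (B - a)))"
      by (intro mult_left_mono) auto
    also have "\<dots> = exp (- (D * B))"
      by (simp add: exp_add[symmetric] algebra_simps)
    finally show ?thesis .
  qed
  have "exp (- (D * a)) \<le> 1" using D0 \<open>0 \<le> a\<close> by simp
  then have "exp (- (D * a)) * (D * (B - a)) \<le> 1 * (D * (B - a))"
    using \<open>a \<le> B\<close> by (intro mult_right_mono) auto
  with \<open>exp (- (D * a)) * (1 - D * (B - a)) \<le> exp (- (D * B))\<close>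
  have "exp (- (D * a)) - exp (- (D * B)) \<le> D * (B - a)"
    by (simp add: algebra_simps)
  then have "\<eta> * (exp (- (D * a)) - exp (- (D * B))) \<le> \<eta> * (D * (B - a))"
    using \<eta>D by (intro mult_left_mono) auto
  then have "(1 - \<eta>) * a + \<eta> * exp (- (D * a)) \<le> (1 - \<eta>) * B + \<eta> * exp (- (D * B))"
    unfolding \<eta>D(1) by (simp add: algebra_simps)
  also have "exp (- (D * B)) \<le> exp (- ln D)"
    using D0 \<open>ln D / D \<le> B\<close> by (simp add: field_simps)
  also have "exp (- ln D) = 1 / real D"
    using D0 by (simp add: exp_minus field_simps)
  also note inv_le
  finally show ?thesis using \<eta>D by simp
qed

lemma sum_lessThan_add:
  fixes f :: "nat \<Rightarrow> 'a::comm_monoid_add"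
  shows "sum f {..<m + k} = sum f {..<m} + (\<Sum>c<k. f (m + c))"
  by (induction k) (simp_all add: add.assoc)

text \<open>The new vertices come last, so each has its transversal as back-neighbourhood. This is
  stable because edges among old vertices stay inside one copy.\<close>

lemma zykov_step:
  assumes G: "weighted_triangle_free D n N \<mu> B"
    and D: "3 \<le> D" and \<eta>: "\<eta> = 1 / (real D + 1)" and B: "ln D / D \<le> B"
  shows "\<exists>n' N' \<mu>'. weighted_triangle_free D n' N' \<mu>' ((1 - \<eta>) * B + \<eta> * (ln D / D))"
proof -
  let ?T = "PiE {..<D} (\<lambda>_. {..<n})"
  have back_lt: "\<And>u v. v < n \<Longrightarrow> u \<in> N v \<Longrightarrow> u < v"
    and cardN: "\<And>v. v < n \<Longrightarrow> card (N v) \<le> D"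
    and tf: "\<And>v. v < n \<Longrightarrow> stable_set N (N v)"
    and \<mu>0: "\<And>v. v < n \<Longrightarrow> 0 \<le> \<mu> v"
    and \<mu>1: "sum \<mu> {..<n} = 1"
    and indep: "\<And>I. I \<subseteq> {..<n} \<Longrightarrow> stable_set N I \<Longrightarrow> sum \<mu> I \<le> B"
    using G by (auto simp: weighted_triangle_free_def back_graph_def)
  have "0 < n" using \<mu>1 by (cases n) auto
  have \<eta>01: "0 < \<eta>" "\<eta> < 1" using D by (auto simp: \<eta>)
  have "card ?T = n ^ D" by (simp add: card_PiE)
  moreover have "finite ?T" by (intro finite_PiE) auto
  ultimately obtain h where h: "bij_betw h {..<n ^ D} ?T"
    using ex_bij_betw_nat_finite[of ?T] by (auto simp: atLeast0LessThan)
  have h_lt: "h c i < n" if "c < n ^ D" "i < D" for c i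
    using bij_betwE[OF h] that by (auto simp: PiE_iff)
  have sum_h: "(\<Sum>c<n ^ D. F (h c)) = sum F ?T" for F :: "(nat \<Rightarrow> nat) \<Rightarrow> real"
    by (rule sum.reindex_bij_betw[OF h])
  \<comment> \<open>Numbering: \<open>i * n + u\<close> is vertex \<open>u\<close> of copy
    \<open>i\<close>, and \<open>M + c\<close> is the new vertex joined to the transversal
    \<open>h c\<close>. Each copy receives total mass \<open>(1 - \<eta>) / D\<close>.\<close>
  define M where "M = D * n"
  define N' where "N' w = (if w < M then (\<lambda>u. (w div n) * n + u) ` N (w mod n)
      else (\<lambda>i. i * n + h (w - M) i) ` {..<D})" for w
  define \<mu>' where "\<mu>' w = (if w < M then (1 - \<eta>) / D * \<mu> (w mod n)
      else \<eta> * (\<Prod>i<D. \<mu> (h (w - M) i)))" for w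
  have slot: "i * n + u < M" if "i < D" "u < n" for i u
  proof -
    have "i * n + u < Suc i * n" using that by simp
    also have "\<dots> \<le> M" unfolding M_def using that by (intro mult_right_mono) auto
    finally show ?thesis .
  qed
  have N'_copy: "N' (i * n + u) = (\<lambda>x. i * n + x) ` N u" if "i < D" "u < n" for i u
    using that slot[OF that] by (simp add: N'_def)
  have \<mu>'_copy: "\<mu>' (i * n + u) = (1 - \<eta>) / D * \<mu> u" if "i < D" "u < n" for i u
    using that slot[OF that] by (simp add: \<mu>'_def)
  have copyE: "\<exists>i u. w = i * n + u \<and> i < D \<and> u < n" if "w < M" for w
    using that \<open>0 < n\<close>
    by (intro exI[of _ "w div n"] exI[of _ "w mod n"])
      (auto simp: M_def less_mult_imp_div_less)
  have sum_split: "(\<Sum>w<M + n ^ D. F w)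
      = (\<Sum>i<D. \<Sum>u<n. F (i * n + u)) + (\<Sum>c<n ^ D. F (M + c))" for F :: "nat \<Rightarrow> real"
  proof -
    have "(\<Sum>u<n. F (i * n + u)) = sum F {i * n..<i * n + n}" for i
      using sum.shift_bounds_nat_ivl[of F 0 "i * n" n]
      by (simp add: atLeast0LessThan add.commute)
    then show ?thesis
      unfolding sum_lessThan_add M_def by (simp add: sum.nat_group)
  qed
  have "weighted_triangle_free D (M + n ^ D) N' \<mu>' ((1 - \<eta>) * B + \<eta> * (ln D / D))"
    unfolding weighted_triangle_free_def
  proof (intro conjI allI impI)
    show "back_graph (M + n ^ D) N'"
      unfolding back_graph_def
    proof (intro allI impI subsetI)
      fix w x assume w: "w < M + n ^ D" and x: "x \<in> N' w"
      show "x \<in> {..<w}"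
      proof (cases "w < M")
        case True
        then obtain i u where "w = i * n + u" "i < D" "u < n" using copyE by blast
        with x back_lt N'_copy show ?thesis by auto
      next
        case False
        with x obtain i where "i < D" "x = i * n + h (w - M) i" by (auto simp: N'_def)
        moreover have "x < M"
          using calculation w False by (auto intro!: slot h_lt)
        ultimately show ?thesis using False by auto
      qed
    qed
  next
    fix w assume w: "w < M + n ^ D"
    show "card (N' w) \<le> D"
    proof (cases "w < M")
      case True
      then obtain i u where iu: "w = i * n + u" "i < D" "u < n" using copyE by blast
      have "finite (N u)" using back_lt[OF iu(3)] by (auto intro: finite_subset[of _ "{..<u}"])
      then show ?thesis
        using cardN[OF iu(3)] card_image_le[of "N u"] iu by (auto simp: N'_copy intro: order_trans)
    next
      case False
      then show ?thesis
        using card_image_le[of "{..<D}" "\<lambda>i. i * n + h (w - M) i"] by (simp add: N'_def)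
    qed
    show "stable_set N' (N' w)"
    proof (cases "w < M")
      case True
      then obtain i u where iu: "w = i * n + u" "i < D" "u < n" using copyE by blast
      have "N' (i * n + x) = (\<lambda>y. i * n + y) ` N x" if "x \<in> N u" for x
        using that iu back_lt[OF iu(3) that] by (intro N'_copy) auto
      then show ?thesis
        using tf[OF iu(3)] iu by (auto simp: N'_copy stable_set_def disjoint_iff)
    next
      case False
      let ?g = "h (w - M)"
      have g: "?g i < n" if "i < D" for i
        using that w False by (intro h_lt) auto
      \<comment> \<open>Division by \<open>n\<close> recovers the copy, so an edge between two
        members of a transversal would force \<open>i = j\<close>; but a back-neighbour of
        \<open>?g i\<close> is smaller than \<open>?g i\<close>.\<close>
      have "i * n + x \<noteq> j * n + ?g j" if "i < D" "j < D" "x \<in> N (?g i)" for i j x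
      proof
        assume eq: "i * n + x = j * n + ?g j"
        have x: "x < ?g i" using back_lt[OF g[OF \<open>i < D\<close>] that(3)] .
        then have "x < n" using g[OF \<open>i < D\<close>] by simp
        then have "i = j"
          using arg_cong[OF eq, of "\<lambda>z. z div n"] g[OF \<open>j < D\<close>] by simp
        with eq x show False by simp
      qed
      then show ?thesis
        using False g by (fastforce simp: stable_set_def N'_def[of w] N'_copy)
    qed
  next
    fix w assume w: "w < M + n ^ D"
    show "0 \<le> \<mu>' w"
      using w \<mu>0 \<eta>01 h_lt \<open>0 < n\<close>
      by (auto simp: \<mu>'_def intro!: mult_nonneg_nonneg prod_nonneg)
  next
    have "(\<Sum>c<n ^ D. \<mu>' (M + c)) = \<eta> * (\<Sum>g\<in>?T. \<Prod>i<D. \<mu> (g i))"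
      using sum_h[of "\<lambda>g. \<Prod>i<D. \<mu> (g i)"] by (simp add: \<mu>'_def sum_distrib_left[symmetric])
    also have "(\<Sum>g\<in>?T. \<Prod>i<D. \<mu> (g i)) = (\<Prod>i<D. sum \<mu> {..<n})"
      by (rule prod_sum_PiE[symmetric]) auto
    finally have "(\<Sum>c<n ^ D. \<mu>' (M + c)) = \<eta>" by (simp add: \<mu>1)
    moreover have "(\<Sum>u<n. \<mu>' (i * n + u)) = (1 - \<eta>) / D" if "i < D" for i
      using that
      by (simp add: \<mu>'_copy sum_divide_distrib[symmetric] sum_distrib_left[symmetric] \<mu>1)
    ultimately show "sum \<mu>' {..<M + n ^ D} = 1"
      unfolding sum_split using D by simp
  next
    fix I assume I: "I \<subseteq> {..<M + n ^ D}" "stable_set N' I"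
    \<comment> \<open>The trace of \<open>I\<close> on copy \<open>i\<close>, and below it its mass
      in the original measure.\<close>
    define J where "J i = {u. u < n \<and> i * n + u \<in> I}" for i
    define a where "a i = sum \<mu> (J i)" for i
    have J: "J i \<subseteq> {..<n}" "stable_set N (J i)" if "i < D" for i
    proof -
      show "J i \<subseteq> {..<n}" by (auto simp: J_def)
      have "N u \<inter> J i = {}" if "u \<in> J i" for u
        using that \<open>i < D\<close> I(2) N'_copy[of i u] by (fastforce simp: J_def stable_set_def)
      then show "stable_set N (J i)" by (auto simp: stable_set_def)
    qed
    have a: "0 \<le> a i" "a i \<le> B" if "i < D" for i
      unfolding a_def using indep[OF J[OF that]] J(1)[OF that] \<mu>0
      by (auto intro!: sum_nonneg)
    have compl: "sum \<mu> ({..<n} - J i) = 1 - a i" if "i < D" for i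
      using J(1)[OF that] by (simp add: sum_diff a_def \<mu>1)
    have "sum \<mu>' I = (\<Sum>w<M + n ^ D. if w \<in> I then \<mu>' w else 0)"
      using I(1) by (simp add: sum.If_cases Int_absorb1)
    also have "\<dots> = (\<Sum>i<D. \<Sum>u<n. if i * n + u \<in> I then \<mu>' (i * n + u) else 0)
        + (\<Sum>c<n ^ D. if M + c \<in> I then \<mu>' (M + c) else 0)"
      by (rule sum_split)
    also have "(\<Sum>i<D. \<Sum>u<n. if i * n + u \<in> I then \<mu>' (i * n + u) else 0)
        = (\<Sum>i<D. (1 - \<eta>) / D * a i)"
    proof (rule sum.cong[OF refl])
      fix i assume "i \<in> {..<D}"
      then have "(\<Sum>u<n. if i * n + u \<in> I then \<mu>' (i * n + u) else 0)
          = (\<Sum>u<n. if i * n + u \<in> I then (1 - \<eta>) / D * \<mu> u else 0)"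
        by (intro sum.cong) (auto simp: \<mu>'_copy)
      also have "\<dots> = (1 - \<eta>) / D * a i"
        by (simp add: sum.If_cases a_def J_def sum_distrib_left Int_def)
      finally show "(\<Sum>u<n. if i * n + u \<in> I then \<mu>' (i * n + u) else 0)
          = (1 - \<eta>) / D * a i" .
    qed
    also have "\<dots> = (1 - \<eta>) * ((\<Sum>i<D. a i) / D)"
      by (simp add: sum_distrib_left sum_divide_distrib)
    \<comment> \<open>A new vertex in \<open>I\<close> forces its transversal to miss every
      \<open>J i\<close>. The resulting sum is over a product set, hence factors into the masses of
      the complements of the \<open>J i\<close>.\<close>
    also have "(\<Sum>c<n ^ D. if M + c \<in> I then \<mu>' (M + c) else 0)
        \<le> (\<Sum>c<n ^ D. if \<forall>i<D. h c i \<notin> J i then \<eta> * (\<Prod>i<D. \<mu> (h c i)) else 0)"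
    proof (rule sum_mono)
      fix c assume c: "c \<in> {..<n ^ D}"
      have "h c i \<notin> J i" if "M + c \<in> I" "i < D" for i
      proof -
        have "N' (M + c) \<inter> I = {}" using I(2) that by (simp add: stable_set_def)
        moreover have "i * n + h c i \<in> N' (M + c)" using that by (simp add: N'_def)
        ultimately show ?thesis by (auto simp: J_def)
      qed
      moreover have "0 \<le> \<eta> * (\<Prod>i<D. \<mu> (h c i))"
        using c \<mu>0 h_lt \<eta>01 by (auto intro!: mult_nonneg_nonneg prod_nonneg)
      ultimately show "(if M + c \<in> I then \<mu>' (M + c) else 0)
          \<le> (if \<forall>i<D. h c i \<notin> J i then \<eta> * (\<Prod>i<D. \<mu> (h c i)) else 0)"
        by (auto simp: \<mu>'_def)
    qed
    also have "\<dots> = (\<Sum>g\<in>?T. if \<forall>i<D. g i \<notin> J i then \<eta> * (\<Prod>i<D. \<mu> (g i)) else 0)"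
      by (rule sum_h)
    also have "\<dots> = (\<Sum>g\<in>PiE {..<D} (\<lambda>i. {..<n} - J i). \<eta> * (\<Prod>i<D. \<mu> (g i)))"
      using \<open>finite ?T\<close> by (subst sum.If_cases) (auto simp: PiE_iff intro!: sum.cong)
    also have "\<dots> = \<eta> * (\<Prod>i<D. sum \<mu> ({..<n} - J i))"
      by (subst prod_sum_PiE) (auto simp: sum_distrib_left)
    also have "(\<Prod>i<D. sum \<mu> ({..<n} - J i)) \<le> (\<Prod>i<D. exp (- a i))"
    proof (rule prod_mono)
      fix i assume "i \<in> {..<D}"
      then have "sum \<mu> ({..<n} - J i) = 1 - a i" by (simp add: compl)
      moreover have "0 \<le> sum \<mu> ({..<n} - J i)" using \<mu>0 by (intro sum_nonneg) auto
      ultimately show "0 \<le> sum \<mu> ({..<n} - J i) \<and> sum \<mu> ({..<n} - J i) \<le> exp (- a i)"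
        using exp_ge_add_one_self[of "- a i"] by simp
    qed
    also have "(\<Prod>i<D. exp (- a i)) = exp (- (D * ((\<Sum>i<D. a i) / D)))"
      using D by (simp add: exp_sum[symmetric] sum_negf)
    \<comment> \<open>Only the average of the \<open>a i\<close> is left, as the product of the
      factors \<open>exp (- a i)\<close> depends on their sum alone.\<close>
    also have "(1 - \<eta>) * ((\<Sum>i<D. a i) / D) + \<eta> * \<dots> \<le> (1 - \<eta>) * B + \<eta> * (ln D / D)"
    proof (rule descent_step[OF D \<eta> _ _ B])
      show "0 \<le> (\<Sum>i<D. a i) / D" using a by (auto intro!: sum_nonneg divide_nonneg_nonneg)
      have "(\<Sum>i<D. a i) \<le> D * B"
        using sum_bounded_above[of "{..<D}" a B] a by simp
      then show "(\<Sum>i<D. a i) / D \<le> B" using D by (simp add: field_simps)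
    qed
    finally show "sum \<mu>' I \<le> (1 - \<eta>) * B + \<eta> * (ln D / D)"
      using \<eta>01 by simp
  qed
  then show ?thesis by blast
qed

text \<open>Starting from a single vertex, each Zykov step multiplies the excess of the bound over
  \<open>ln D / D\<close> by \<open>1 - \<eta>\<close>. The excess tends to 0, so any bound strictly
  above that limit is reached.\<close>

lemma weighted_triangle_free_exists:
  assumes D: "3 \<le> D" and B: "ln (real D) / D < B"
  shows "\<exists>n N \<mu>. weighted_triangle_free D n N \<mu> B"
proof -
  define \<eta> where "\<eta> = 1 / (real D + 1)"
  have \<eta>01: "0 < \<eta>" "\<eta> < 1" using D by (auto simp: \<eta>_def)
  define L where "L = ln (real D) / D"
  have L0: "0 \<le> L" using D by (simp add: L_def)
  have "\<exists>n N \<mu>. weighted_triangle_free D n N \<mu> (L + (1 - \<eta>) ^ k)" for k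
  proof (induction k)
    case 0
    have "weighted_triangle_free D 1 (\<lambda>_. {}) (\<lambda>_. 1) 1"
      unfolding weighted_triangle_free_def
      by (auto simp: back_graph_def stable_set_def dest: card_mono[OF finite_lessThan])
    with L0 show ?case by (force intro: weighted_triangle_free_mono)
  next
    case (Suc k)
    then obtain n N \<mu> where "weighted_triangle_free D n N \<mu> (L + (1 - \<eta>) ^ k)"
      by blast
    from zykov_step[OF this D \<eta>_def, folded L_def]
    have "\<exists>n N \<mu>. weighted_triangle_free D n N \<mu>
        ((1 - \<eta>) * (L + (1 - \<eta>) ^ k) + \<eta> * (L))"
      using \<eta>01 by (simp add: L_def)
    moreover have "(1 - \<eta>) * (L + q) + \<eta> * L = L + (1 - \<eta>) * q" for L q :: real
      by (simp add: algebra_simps)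
    ultimately show ?case by simp
  qed
  moreover obtain k where "(1 - \<eta>) ^ k < B - L"
    using real_arch_pow_inv[of "B - L" "1 - \<eta>"] B \<eta>01 by (auto simp: L_def)
  moreover from this have "L + (1 - \<eta>) ^ k \<le> B" by simp
  ultimately show ?thesis
    by (meson weighted_triangle_free_mono)
qed

section \<open>Replacing vertices by cliques\<close>

lemma card_fibres_div_le:
  fixes t :: nat
  assumes "finite Q" "0 < t"
  shows "finite {u. u div t \<in> Q}" and "card {u. u div t \<in> Q} \<le> card Q * t"
proof -
  have sub: "{u. u div t \<in> Q} \<subseteq> (\<Union>q\<in>Q. {q * t..<q * t + t})"
  proof
    fix u assume "u \<in> {u. u div t \<in> Q}"
    then have "u div t \<in> Q" "u div t * t \<le> u" "u < u div t * t + t"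
      using dividend_less_div_times[of t u] assms(2) by (auto simp: add.commute)
    then show "u \<in> (\<Union>q\<in>Q. {q * t..<q * t + t})" by fastforce
  qed
  have fin: "finite (\<Union>q\<in>Q. {q * t..<q * t + t})" using assms(1) by auto
  from sub fin show "finite {u. u div t \<in> Q}" by (rule finite_subset)
  have "card {u. u div t \<in> Q} \<le> card (\<Union>q\<in>Q. {q * t..<q * t + t})"
    by (rule card_mono[OF fin sub])
  also have "\<dots> \<le> (\<Sum>q\<in>Q. card {q * t..<q * t + t})"
    by (rule card_UN_le[OF assms(1)])
  finally show "card {u. u div t \<in> Q} \<le> card Q * t" by simp
qed

text \<open>Vertex \<open>w\<close> lies in the clique numbered \<open>w div t\<close>. Its
  back-neighbours are in cliques over \<open>N (w div t)\<close> (\<open>far\<close>) or earlier in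
  its own clique (\<open>near\<close>). An independent set meets each clique at most once and
  projects to a stable set, so its mass stays at most \<open>B\<close> while the total mass grows to
  \<open>t\<close>.\<close>

lemma blow_up:
  assumes G: "weighted_triangle_free D n N \<mu> B" and "0 < t" "0 < B"
  shows "\<exists>(V::nat set) E vs. simple_graph V E \<and> degeneracy_ordering V E (D * t + (t - 1)) vs \<and>
    (\<forall>i<length vs. card (induced_edges E (back_nbhd E vs i)) \<le> (2 * D + 1) * t * (t - 1)) \<and>
    real t / B \<le> fractional_chromatic_number V E"
proof -
  have back_lt: "\<And>u v. v < n \<Longrightarrow> u \<in> N v \<Longrightarrow> u < v"
    and cardN: "\<And>v. v < n \<Longrightarrow> card (N v) \<le> D"
    and tf: "\<And>v. v < n \<Longrightarrow> stable_set N (N v)"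
    and \<mu>0: "\<And>v. v < n \<Longrightarrow> 0 \<le> \<mu> v"
    and \<mu>1: "sum \<mu> {..<n} = 1"
    and indep: "\<And>I. I \<subseteq> {..<n} \<Longrightarrow> stable_set N I \<Longrightarrow> sum \<mu> I \<le> B"
    using G by (auto simp: weighted_triangle_free_def back_graph_def)
  define N' where "N' w = {u. u < w \<and> (u div t \<in> N (w div t) \<or> u div t = w div t)}" for w
  let ?V = "{..<n * t}" and ?E = "edges_of (n * t) N'" and ?vs = "[0..<n * t]"
  have bg: "back_graph (n * t) N'" by (auto simp: back_graph_def N'_def)
  have div_lt: "w div t < n" if "w < n * t" for w
    using that \<open>0 < t\<close> by (simp add: less_mult_imp_div_less)
  have finN: "finite (N v)" if "v < n" for v
    using back_lt[OF that] by (auto intro: finite_subset[of _ "{..<v}"])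
  define far where "far w = {u. u div t \<in> N (w div t)}" for w
  define near where "near w = {u. u < w \<and> u div t = w div t}" for w
  have fibre: "finite {u. u div t = q}" "card {u. u div t = q} \<le> t" for q
    using card_fibres_div_le[of "{q}" t] \<open>0 < t\<close> by auto
  have fibre': "card ({u. u div t = w div t} - {w}) \<le> t - 1" for w
    using fibre[of "w div t"] by (subst card_Diff_singleton) auto
  have near: "finite (near w)" "card (near w) \<le> t - 1" for w
  proof -
    have sub: "near w \<subseteq> {u. u div t = w div t} - {w}" by (auto simp: near_def)
    show "finite (near w)" by (simp add: near_def)
    show "card (near w) \<le> t - 1"
      using card_mono[OF _ sub] fibre' fibre(1) by (meson finite_Diff order_trans)
  qed
  have far: "finite (far w)" "card (far w) \<le> D * t" if "w < n * t" for w
    using card_fibres_div_le[OF finN[OF div_lt[OF that]] \<open>0 < t\<close>] cardN[OF div_lt[OF that]]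
    by (auto simp: far_def intro: order_trans)
  have N'_sub: "N' w \<subseteq> far w \<union> near w" for w
    by (auto simp: N'_def far_def near_def)
  have card_nbrs: "card (far w \<union> near w) \<le> D * t + (t - 1)" if "w < n * t" for w
    using card_Un_le[of "far w" "near w"] far[OF that] near[of w] by linarith
  have card_N': "card (N' w) \<le> D * t + (t - 1)" if "w < n * t" for w
    using card_mono[OF _ N'_sub] far[OF that] near card_nbrs[OF that]
    by (meson finite_UnI order_trans)
  have "degeneracy_ordering ?V ?E (D * t + (t - 1)) ?vs"
    using card_N' by (simp add: degeneracy_ordering_def vertex_ordering_upt back_nbhd_edges_of[OF bg])
  moreover have "card (induced_edges ?E (N' w)) \<le> (2 * D + 1) * t * (t - 1)" if w: "w < n * t" for w
  proof -
    \<comment> \<open>\<open>P\<close> covers the edges within \<open>far w\<close>, as ordered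
      pairs from one clique; \<open>Q\<close> covers the edges with an end in
      \<open>near w\<close>.\<close>
    define P where "P = Sigma (far w) (\<lambda>y. {x. x div t = y div t} - {y})"
    define Q where "Q = near w \<times> (far w \<union> near w)"
    have fin: "finite P" "finite Q"
      using far[OF w] near[of w] fibre by (auto simp: P_def Q_def)
    have "induced_edges ?E (N' w) \<subseteq> (\<lambda>(x, y). {x, y}) ` (P \<union> Q)"
    proof
      fix e assume "e \<in> induced_edges ?E (N' w)"
      then obtain x y where e: "e = {x, y}" "y < n * t" "x \<in> N' y" "x \<in> N' w" "y \<in> N' w"
        by (auto simp: induced_edges_def edges_of_def)
      have xy: "x < y" "x div t \<in> N (y div t) \<or> x div t = y div t"
        using e(3) by (auto simp: N'_def)
      have mem: "x \<in> far w \<union> near w" "y \<in> far w \<union> near w"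
        using e(4,5) N'_sub by auto
      consider "x \<in> near w" | "y \<in> near w" | "x \<in> far w" "y \<in> far w"
        using mem by blast
      then show "e \<in> (\<lambda>(x, y). {x, y}) ` (P \<union> Q)"
      proof cases
        case 1
        with mem have "(x, y) \<in> Q" by (simp add: Q_def)
        then show ?thesis using e(1) by force
      next
        case 2
        with mem have "(y, x) \<in> Q" by (simp add: Q_def)
        then show ?thesis using e(1) by (force simp: insert_commute)
      next
        \<comment> \<open>Both cliques lie over the stable set \<open>N (w div t)\<close>, so
          adjacent \<open>x\<close> and \<open>y\<close> must share a clique.\<close>
        case 3
        then have "x div t \<notin> N (y div t)"
          using tf[OF div_lt[OF w]] by (auto simp: far_def stable_set_def)
        with xy have "(y, x) \<in> P" using 3 by (auto simp: P_def)
        then show ?thesis using e(1) by (force simp: insert_commute)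
      qed
    qed
    then have "card (induced_edges ?E (N' w)) \<le> card (P \<union> Q)"
      using fin by (meson card_image_le card_mono finite_UnI finite_imageI order_trans)
    also have "\<dots> \<le> card P + card Q" by (rule card_Un_le)
    also have "card P \<le> card (far w) * (t - 1)"
      unfolding P_def using far[OF w] fibre fibre'
      by (subst card_SigmaI) (auto intro!: sum_bounded_above[where 'a=nat, simplified])
    also have "card (far w) * (t - 1) \<le> D * t * (t - 1)"
      using far[OF w] by (intro mult_right_mono) auto
    also have "card Q \<le> (t - 1) * (D * t + (t - 1))"
      unfolding Q_def card_cartesian_product
      using near card_nbrs[OF w] by (intro mult_mono) auto
    \<comment> \<open>Rounding \<open>t - 1\<close> up to \<open>t\<close> makes the two bounds add
      up to exactly \<open>(2 * D + 1) * t * (t - 1)\<close>.\<close>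
    also have "\<dots> \<le> (t - 1) * (D * t + t)"
      by (intro mult_left_mono) auto
    also have "D * t * (t - 1) + (t - 1) * (D * t + t) = (2 * D + 1) * t * (t - 1)"
      by (simp add: distrib_left distrib_right mult_ac)
    finally show ?thesis by simp
  qed
  then have "\<forall>i<length ?vs. card (induced_edges ?E (back_nbhd ?E ?vs i)) \<le> (2 * D + 1) * t * (t - 1)"
    by (simp add: back_nbhd_edges_of[OF bg])
  moreover have "real t / B \<le> fractional_chromatic_number ?V ?E"
  proof -
    \<comment> \<open>Every clique member keeps the full weight of the vertex it replaces.\<close>
    have "(\<Sum>w<n * t. \<mu> (w div t)) = (\<Sum>v<n. \<Sum>w\<in>{v * t..<v * t + t}. \<mu> (w div t))"
      by (rule sum.nat_group[symmetric])
    also have "\<dots> = (\<Sum>v<n. t * \<mu> v)"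
    proof (rule sum.cong[OF refl])
      fix v
      have "w div t = v" if "w \<in> {v * t..<v * t + t}" for w
        using that by (intro div_nat_eqI) (auto simp: algebra_simps)
      then show "(\<Sum>w\<in>{v * t..<v * t + t}. \<mu> (w div t)) = t * \<mu> v" by simp
    qed
    also have "\<dots> = t" by (simp add: sum_distrib_left[symmetric] \<mu>1)
    finally have total: "(\<Sum>w<n * t. \<mu> (w div t)) = t" .
    have "(\<Sum>w\<in>I. \<mu> (w div t)) \<le> B" if "I \<in> indep_sets ?V ?E" for I
    proof -
      note I = indep_sets_edges_of[OF that]
      have nadj: "u \<notin> N' w" if "u \<in> I" "w \<in> I" for u w
        using I(2) that by (auto simp: stable_set_def)
      have inj: "inj_on (\<lambda>w. w div t) I"
      proof (rule inj_onI)
        fix u w assume "u \<in> I" "w \<in> I" "u div t = w div t"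
        with nadj[of u w] nadj[of w u] show "u = w" by (auto simp: N'_def)
      qed
      have "stable_set N ((\<lambda>w. w div t) ` I)"
        unfolding stable_set_def
      proof (intro ballI equals0I)
        fix v x assume "v \<in> (\<lambda>w. w div t) ` I" "x \<in> N v \<inter> (\<lambda>w. w div t) ` I"
        then obtain w u where wu: "w \<in> I" "u \<in> I" "u div t \<in> N (w div t)" by auto
        with I(1) have "u div t < w div t" by (intro back_lt[OF div_lt]) auto
        then have "u < w" by (meson div_le_mono leD leI)
        with wu nadj[of u w] show False by (auto simp: N'_def)
      qed
      moreover have "(\<lambda>w. w div t) ` I \<subseteq> {..<n}" using I(1) div_lt by auto
      ultimately have "sum \<mu> ((\<lambda>w. w div t) ` I) \<le> B" by (rule indep[rotated])
      then show ?thesis by (simp add: sum.reindex[OF inj])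
    qed
    from fractional_chromatic_number_ge[OF simple_graph_edges_of[OF bg] \<open>0 < B\<close> _ this] show ?thesis
      using \<mu>0 div_lt by (simp add: total)
  qed
  ultimately show ?thesis using simple_graph_edges_of[OF bg] by blast
qed

section \<open>Choice of the parameters\<close>

theorem theorem1p7:
  fixes \<epsilon> :: real
  assumes "0 < \<epsilon>" and "\<epsilon> < 1"
  shows "\<exists>(C::real) (d\<^sub>0::nat). C > 0 \<and>
    (\<forall>(d::nat) (f::real). d \<ge> d\<^sub>0 \<longrightarrow> f \<ge> C \<longrightarrow>
      (\<exists>(V::nat set) (E::nat set set).
         simple_graph V E \<and>
         degenerate V E d \<and>
         (\<exists>vs. degeneracy_ordering V E d vs \<and>
               left_locally_sparse V E ((real d)\<^sup>2 / f) vs) \<and>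
         fractional_chromatic_number V E \<ge> (1 - \<epsilon>) * (real d / ln f)))"
proof -
  \<comment> \<open>\<open>C\<close> gives \<open>8 / \<epsilon> \<le> ln f\<close>, which absorbs
    \<open>ln 3\<close> when \<open>ln D\<close> is compared with \<open>ln f\<close>, and also
    \<open>8 / \<epsilon> \<le> f\<close>. \<open>d\<^sub>0\<close> gives
    \<open>16 / \<epsilon>\<^sup>2 \<le> ln d\<close>, which absorbs
    \<open>ln (12 / \<epsilon>)\<close> when \<open>f\<close> is large.\<close>
  define C where "C = exp (8 / \<epsilon>)"
  define d\<^sub>0 where "d\<^sub>0 = nat \<lceil>exp (16 / \<epsilon>\<^sup>2)\<rceil>"
  have "8 / \<epsilon> > 8" using assms by (simp add: field_simps)
  moreover have "8 / \<epsilon> + 1 \<le> C" unfolding C_def using exp_ge_add_one_self[of "8 / \<epsilon>"] by linarith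
  ultimately have C: "9 < C" "8 / \<epsilon> \<le> C" by auto
  have "\<exists>(V::nat set) (E::nat set set). simple_graph V E \<and> degenerate V E d \<and>
         (\<exists>vs. degeneracy_ordering V E d vs \<and>
               left_locally_sparse V E ((real d)\<^sup>2 / f) vs) \<and>
         fractional_chromatic_number V E \<ge> (1 - \<epsilon>) * (real d / ln f)"
    if d: "d \<ge> d\<^sub>0" and f: "f \<ge> C" for d f
  proof -
    have lnf: "8 / \<epsilon> \<le> ln f"
      using f C by (subst ln_ge_iff) (auto simp: C_def)
    have "exp (16 / \<epsilon>\<^sup>2) \<le> d" using d unfolding d\<^sub>0_def by linarith
    moreover have "16 / \<epsilon>\<^sup>2 > 16" using assms by (simp add: field_simps power_less_one_iff)
    moreover have "16 / \<epsilon>\<^sup>2 + 1 \<le> exp (16 / \<epsilon>\<^sup>2)"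
      using exp_ge_add_one_self[of "16 / \<epsilon>\<^sup>2"] by linarith
    ultimately have d3: "3 \<le> d" and lnd: "16 / \<epsilon>\<^sup>2 \<le> ln d"
      by (auto simp: ln_ge_iff)
    have construct: ?thesis
      if "3 \<le> D" "0 < t" "D * t + (t - 1) \<le> d"
        and sparse: "real ((2 * D + 1) * t * (t - 1)) \<le> (real d)\<^sup>2 / f"
        and large: "(1 - \<epsilon>) * (real d / ln f) \<le> real t * D / ((1 + \<epsilon> / 4) * ln D)" for D t :: nat
    proof -
      \<comment> \<open>The factor \<open>1 + \<epsilon> / 4\<close> supplies the strict inequality
        under which the Zykov iteration ends after finitely many steps.\<close>
      define B where "B = (1 + \<epsilon> / 4) * (ln D / D)"
      have pos: "0 < ln (real D) / D" using \<open>3 \<le> D\<close> by simp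
      with assms have B: "ln D / D < B" "0 < B"
        unfolding B_def by (simp_all only: mult_less_cancel_right1 zero_less_mult_iff) auto
      obtain n N \<mu> where "weighted_triangle_free D n N \<mu> B"
        using weighted_triangle_free_exists[OF \<open>3 \<le> D\<close> B(1)] by blast
      from blow_up[OF this \<open>0 < t\<close> B(2)] obtain V :: "nat set" and E vs
        where G: "simple_graph V E" "degeneracy_ordering V E (D * t + (t - 1)) vs"
          "\<And>i. i < length vs \<Longrightarrow>
            card (induced_edges E (back_nbhd E vs i)) \<le> (2 * D + 1) * t * (t - 1)"
          "real t / B \<le> fractional_chromatic_number V E"
        by blast
      have deg: "degeneracy_ordering V E d vs"
        using G(2) \<open>D * t + (t - 1) \<le> d\<close> by (force simp: degeneracy_ordering_def)
      have "int (card (induced_edges E (back_nbhd E vs i))) \<le> \<lfloor>(real d)\<^sup>2 / f\<rfloor>"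
        if "i < length vs" for i
        using of_nat_mono[OF G(3)[OF that], where 'a = real] sparse
        by (simp add: le_floor_iff del: of_nat_mult of_nat_add)
      then have "left_locally_sparse V E ((real d)\<^sup>2 / f) vs"
        using deg by (simp add: left_locally_sparse_def degeneracy_ordering_def)
      moreover have "real t / B = real t * D / ((1 + \<epsilon> / 4) * ln D)"
        by (simp add: B_def)
      ultimately show ?thesis
        using G(1,4) deg large unfolding degenerate_def by (metis order_trans)
    qed
    show ?thesis
    proof (cases "\<epsilon> / 12 * d \<le> f")
      case True
      show ?thesis
      \<comment> \<open>With \<open>t = 1\<close> back-neighbourhoods span no edges, and
        \<open>ln f\<close> is at least \<open>(1 - 3 * \<epsilon> / 4) * ln d\<close>.\<close>
      proof (rule construct[of d 1])
        have "ln (\<epsilon> / 12 * d) \<le> ln f"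
          using True assms d3 by (intro ln_mono) auto
        moreover have "ln (\<epsilon> / 12 * d) = ln d - ln (12 / \<epsilon>)"
          using assms d3 by (simp add: ln_mult ln_div)
        moreover have "ln (12 / \<epsilon>) \<le> 12 / \<epsilon>"
          using assms ln_le_minus_one[of "12 / \<epsilon>"] by simp
        moreover have "12 / \<epsilon> \<le> 3 * \<epsilon> / 4 * ln d"
        proof -
          have "3 * \<epsilon> / 4 * (16 / \<epsilon>\<^sup>2) \<le> 3 * \<epsilon> / 4 * ln d"
            using lnd assms by (intro mult_left_mono) auto
          then show ?thesis using assms by (simp add: power2_eq_square field_simps)
        qed
        ultimately have "(1 - 3 * \<epsilon> / 4) * ln d \<le> ln f"
          by (simp add: algebra_simps)
        moreover have "(1 - \<epsilon>) * (1 + \<epsilon> / 4) \<le> 1 - 3 * \<epsilon> / 4"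
          using assms by (simp add: algebra_simps)
        moreover have "0 < ln (real d)" using d3 by simp
        ultimately have "(1 - \<epsilon>) * (1 + \<epsilon> / 4) * ln d \<le> ln f"
          by (meson mult_right_mono less_imp_le order_trans)
        then have "(1 - \<epsilon>) * ((1 + \<epsilon> / 4) * ln d) * d \<le> ln f * d"
          by (intro mult_right_mono) (auto simp: mult.assoc)
        moreover have "0 < ln f" "0 < (1 + \<epsilon> / 4) * ln d"
          using lnf assms \<open>0 < ln (real d)\<close> by (auto intro: less_le_trans[OF _ lnf])
        ultimately show "(1 - \<epsilon>) * (real d / ln f) \<le> real 1 * d / ((1 + \<epsilon> / 4) * ln d)"
          by (simp add: pos_le_divide_eq pos_divide_le_eq mult_ac)
      qed (use d3 f C in auto)
    next
      case False
      \<comment> \<open>As \<open>f\<close> is at most \<open>(D + 1) / 2\<close>, the edge bound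
        times \<open>f\<close> is at most \<open>(t * (D + 1))\<^sup>2\<close>, and \<open>t\<close>
        is the largest integer for which \<open>t * (D + 1) \<le> d\<close>.\<close>
      define D where "D = nat \<lceil>2 * f\<rceil>"
      define t where "t = d div (D + 1)"
      have D: "2 * f \<le> D" "D \<le> 2 * f + 1" "3 \<le> D"
        using f C unfolding D_def by linarith+
      have "D \<le> 3 * f" using D(2) f C by linarith
      have f12: "12 * f < \<epsilon> * d" using False by simp
      have "\<epsilon> * d \<le> d" using assms by (simp add: mult_left_le_one_le)
      have "D + 1 \<le> d"
        using f12 \<open>D \<le> 3 * f\<close> f C \<open>\<epsilon> * d \<le> d\<close> by linarith
      then have "0 < t" by (simp add: t_def div_greater_zero_iff)
      have t_le: "t * (D + 1) \<le> d" unfolding t_def by (rule div_times_less_eq_dividend)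
      have "d < t * (D + 1) + (D + 1)"
        unfolding t_def using dividend_less_div_times[of "D + 1" d] by simp
      then have t_ge: "real d < t * (real D + 1) + (real D + 1)"
        by (metis of_nat_less_iff of_nat_add of_nat_mult of_nat_1)
      show ?thesis
      proof (rule construct[of D t])
        show "D * t + (t - 1) \<le> d" using t_le by (simp add: algebra_simps)
        have "(2 * D + 1) * t * (t - 1) \<le> 2 * (D + 1) * t * t"
          by (intro mult_mono) auto
        then have "real ((2 * D + 1) * t * (t - 1)) \<le> real (2 * (D + 1) * t * t)"
          by (rule of_nat_mono)
        then have "real ((2 * D + 1) * t * (t - 1)) * f \<le> real (2 * (D + 1) * t * t) * (real (D + 1) / 2)"
          using D(1) f C by (intro mult_mono) auto
        also have "\<dots> = (real (t * (D + 1)))\<^sup>2" by (simp add: power2_eq_square field_simps)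
        also have "\<dots> \<le> (real d)\<^sup>2" using of_nat_mono[OF t_le] by (intro power_mono) simp_all
        finally show "real ((2 * D + 1) * t * (t - 1)) \<le> (real d)\<^sup>2 / f"
          using f C by (simp add: pos_le_divide_eq)
      next
        have L: "0 < ln f" "0 < ln (real D)"
          using lnf assms D(3) by (auto intro: less_le_trans[OF _ lnf])
        have "ln (real D) \<le> ln (3 * f)"
          using D \<open>D \<le> 3 * f\<close> by (intro ln_mono) auto
        also have "\<dots> = ln 3 + ln f" using f C by (simp add: ln_mult)
        also have "ln (3::real) \<le> 2" using ln_le_minus_one[of 3] by simp
        also have "2 \<le> \<epsilon> / 4 * ln f" using lnf assms by (simp add: field_simps)
        finally have lnD: "ln D \<le> (1 + \<epsilon> / 4) * ln f" by (simp add: algebra_simps)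
        have "t < d / (2 * f)"
        proof -
          have "t * (2 * f) < t * (real D + 1)" using D(1) \<open>0 < t\<close> by simp
          also have "\<dots> \<le> d" using of_nat_mono[OF t_le, where 'a = real] by (simp add: algebra_simps)
          finally show ?thesis using f C by (simp add: pos_less_divide_eq)
        qed
        also have "d / (2 * f) \<le> \<epsilon> / 16 * d"
        proof -
          have "8 \<le> \<epsilon> * f" using order_trans[OF C(2) f] assms by (simp add: field_simps)
          then have "8 * real d \<le> \<epsilon> * f * d" by (intro mult_right_mono) auto
          then show ?thesis using f C by (simp add: field_simps)
        qed
        \<comment> \<open>By \<open>t_ge\<close>, \<open>t * D\<close> exceeds
          \<open>d - t - (D + 1)\<close>. Here \<open>t\<close> is below
          \<open>\<epsilon> * d / 16\<close>, and \<open>D + 1 < 4 * f < \<epsilon> * d / 3\<close>,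
          which is less than \<open>6 * \<epsilon> * d / 16\<close>.\<close>
        finally have "(1 - 7 * \<epsilon> / 16) * d \<le> real t * D"
          using t_ge \<open>D \<le> 3 * f\<close> f12 f C D
          by (simp add: algebra_simps)
        \<comment> \<open>One factor \<open>1 + \<epsilon> / 4\<close> is the slack in
          \<open>B\<close>, the other comes from \<open>lnD\<close>.\<close>
        moreover have "(1 - \<epsilon>) * (1 + \<epsilon> / 4)\<^sup>2 \<le> 1 - 7 * \<epsilon> / 16"
        proof -
          have "(1 - \<epsilon>) * (1 + \<epsilon> / 4)\<^sup>2 = 1 - \<epsilon> / 2 - 7 / 16 * \<epsilon>\<^sup>2 - \<epsilon> ^ 3 / 16"
            by (simp add: power2_eq_square power3_eq_cube field_simps)
          moreover have "0 \<le> \<epsilon>\<^sup>2" "0 \<le> \<epsilon> ^ 3" using assms by auto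
          ultimately show ?thesis using assms by linarith
        qed
        ultimately have tD: "(1 - \<epsilon>) * (1 + \<epsilon> / 4)\<^sup>2 * d \<le> real t * D"
          by (meson mult_right_mono of_nat_0_le_iff order_trans)
        have "(1 - \<epsilon>) * d * ((1 + \<epsilon> / 4) * ln D)
            \<le> (1 - \<epsilon>) * d * ((1 + \<epsilon> / 4) * ((1 + \<epsilon> / 4) * ln f))"
          using lnD assms by (intro mult_left_mono) auto
        also have "\<dots> = (1 - \<epsilon>) * (1 + \<epsilon> / 4)\<^sup>2 * d * ln f"
          by (simp add: power2_eq_square)
        also have "\<dots> \<le> real t * D * ln f" using tD L by (intro mult_right_mono) auto
        finally have "(1 - \<epsilon>) * d * ((1 + \<epsilon> / 4) * ln D) \<le> real t * D * ln f" .
        moreover have "0 < (1 + \<epsilon> / 4) * ln D" using L assms by auto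
        ultimately show "(1 - \<epsilon>) * (real d / ln f) \<le> real t * D / ((1 + \<epsilon> / 4) * ln D)"
          using L(1) by (simp add: pos_le_divide_eq pos_divide_le_eq mult_ac)
      qed (use D \<open>0 < t\<close> in auto)
    qed
  qed
  then show ?thesis using C by (intro exI[of _ C] exI[of _ d\<^sub>0]) auto
qed

end
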